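(* Let $\mathsf{Boxes}$ and $\mathsf{Inputs}$ be types, let $\mathsf{Arity} : \mathsf{Boxes} \to \mathsf{Type}$, let $\mathsf{Dom}(b,a)$ be a polynomial for each $b : \mathsf{Boxes}$ and $a : \mathsf{Arity}(b)$, let $\mathsf{Cod}(b)$ be a polynomial for each $b : \mathsf{Boxes}$, and let $\mathsf{inputs}(i)$ be a polynomial for each $i : \mathsf{Inputs}$. Let $p$ be a polynomial and let $W : \mathsf{Wiring}(p)$ be a wiring diagram with output interface $p$. Suppose that for each box $b : \mathsf{Boxes}$ we are given an implementation $$g_b : \mathsf{Cod}(b) \Rightarrow \mathsf{Free}\big(\mathsf{sum}\,(\mathsf{Arity}\,b)\,(\mathsf{Dom}\,b)\big).$$ Then there is an induced implementation $p \Rightarrow \mathsf{Free}\big(\mathsf{sum}\,\mathsf{Inputs}\,\mathsf{inputs}\big)$.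
   Context: Work in dependent type theory, with $\mathsf{Type}$ a universe of types. A polynomial is a pair $p=(A,B)$ with $A$ a type (positions) and $B : A \to \mathsf{Type}$ (directions). For a polynomial $(A,B)$ and a function $F : \mathsf{Type}\to\mathsf{Type}$, write $(A,B) \Rightarrow F$ for the type $\prod_{a:A} F(B(a))$. For a polynomial $p=(A,B)$ and type $C$, the free monad $\mathsf{Free}\,p\,C$ is the inductive type with constructors $\mathsf{return} : C \to \mathsf{Free}\,p\,C$ and $\mathsf{bind} : \prod_{a:A} (B(a) \to \mathsf{Free}\,p\,C) \to \mathsf{Free}\,p\,C$. An implementation of interface $p$ depending on interface $q$ is an element of $p \Rightarrow \mathsf{Free}\,q$. For a type $U$ and a family of polynomials $P(u)=(A_u,B_u)$, $u:U$, the sum is the polynomial $\mathsf{sum}\,U\,P = \big(\sum_{u:U} A_u,\ (u,x)\mapsto B_u(x)\big)$. Given the data $\mathsf{Boxes},\mathsf{Arity},\mathsf{Dom},\mathsf{Cod},\mathsf{Inputs},\mathsf{inputs}$ as in the claim, the type family of wiring diagrams $\mathsf{Wiring}(o)$, indexed by polynomials $o$, is inductively generated by: $\mathsf{wire}(i) : \mathsf{Wiring}(\mathsf{inputs}(i))$ for $i:\mathsf{Inputs}$; and $\mathsf{box}(b,f) : \mathsf{Wiring}(\mathsf{Cod}(b))$ for $b : \mathsf{Boxes}$ and $f : \prod_{a:\mathsf{Arity}(b)} \mathsf{Wiring}(\mathsf{Dom}(b,a))$. *)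

theory Defs
  imports Main "HOL-Library.FuncSet"
begin

text \<open>
  Types of the dependent theory are rendered as sets over HOL types, and dependent products as
  extensional function spaces \<open>PiE\<close>, so that a dependent function is determined by its values
  on its domain. For the same reason the directions of a polynomial are taken to be
  extensional on its positions: equality of polynomials, which is what the indexing of wiring
  diagrams is sensitive to, is then equality of \<open>(A, B)\<close> with \<open>B\<close> a family over \<open>A\<close>.
\<close>

datatype ('a, 'd) pre_poly = Poly (positions: "'a set") (directions: "'a \<Rightarrow> 'd set")

definition polynomial :: "('a, 'd) pre_poly \<Rightarrow> bool" where
  "polynomial p \<longleftrightarrow> directions p \<in> extensional (positions p)"

definition poly_arrow :: "('a, 'd) pre_poly \<Rightarrow> ('d set \<Rightarrow> 'x set) \<Rightarrow> ('a \<Rightarrow> 'x) set"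
    (infixr \<open>\<Rrightarrow>\<close> 60) where
  "p \<Rrightarrow> F = (\<Pi>\<^sub>E a\<in>positions p. F (directions p a))"

definition poly_sum :: "'u set \<Rightarrow> ('u \<Rightarrow> ('a, 'd) pre_poly) \<Rightarrow> ('u \<times> 'a, 'd) pre_poly" where
  "poly_sum U P =
     Poly (SIGMA u:U. positions (P u))
          (\<lambda>(u, x)\<in>(SIGMA u:U. positions (P u)). directions (P u) x)"

datatype ('a, 'd, 'c) tree = Return 'c | Bind 'a "'d \<Rightarrow> ('a, 'd, 'c) tree"

inductive_set Free :: "('a, 'd) pre_poly \<Rightarrow> 'c set \<Rightarrow> ('a, 'd, 'c) tree set"
  for p :: "('a, 'd) pre_poly" and C :: "'c set" where
  Return: "c \<in> C \<Longrightarrow> Return c \<in> Free p C"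
| Bind: "a \<in> positions p \<Longrightarrow> k \<in> extensional (directions p a) \<Longrightarrow>
    (\<And>d. d \<in> directions p a \<Longrightarrow> k d \<in> Free p C) \<Longrightarrow> Bind a k \<in> Free p C"

datatype ('b, 'r, 'i) diagram = Wire 'i | Box 'b "'r \<Rightarrow> ('b, 'r, 'i) diagram"

text \<open>\<open>wiring Boxes Arity Dom Cod Inputs inputs p W\<close> renders \<open>W : Wiring(p)\<close>.\<close>

inductive wiring ::
  "'b set \<Rightarrow> ('b \<Rightarrow> 'r set) \<Rightarrow> ('b \<Rightarrow> 'r \<Rightarrow> ('a, 'd) pre_poly) \<Rightarrow> ('b \<Rightarrow> ('a, 'd) pre_poly) \<Rightarrow>
   'i set \<Rightarrow> ('i \<Rightarrow> ('a, 'd) pre_poly) \<Rightarrow> ('a, 'd) pre_poly \<Rightarrow> ('b, 'r, 'i) diagram \<Rightarrow> bool"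
  for Boxes :: "'b set" and Arity :: "'b \<Rightarrow> 'r set"
    and Dom :: "'b \<Rightarrow> 'r \<Rightarrow> ('a, 'd) pre_poly" and Cod :: "'b \<Rightarrow> ('a, 'd) pre_poly"
    and Inputs :: "'i set" and inputs :: "'i \<Rightarrow> ('a, 'd) pre_poly" where
  wire: "i \<in> Inputs \<Longrightarrow> wiring Boxes Arity Dom Cod Inputs inputs (inputs i) (Wire i)"
| box: "b \<in> Boxes \<Longrightarrow> f \<in> extensional (Arity b) \<Longrightarrow>
    (\<And>a. a \<in> Arity b \<Longrightarrow> wiring Boxes Arity Dom Cod Inputs inputs (Dom b a) (f a)) \<Longrightarrow>
    wiring Boxes Arity Dom Cod Inputs inputs (Cod b) (Box b f)"

text \<open>
  Monadic composition in \<open>Free q\<close>, and the translation of \<open>Free p\<close> into \<open>Free q\<close> that runs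
  an implementation \<open>h\<close> of \<open>p\<close> in place of each node. The argument \<open>q\<close> is needed only to keep
  the continuations extensional.
\<close>

primrec free_bind :: "('a, 'd) pre_poly \<Rightarrow> ('a, 'd, 'c) tree \<Rightarrow> ('c \<Rightarrow> ('a, 'd, 'e) tree) \<Rightarrow>
    ('a, 'd, 'e) tree" where
  "free_bind q (Return c) k = k c"
| "free_bind q (Bind a t) k = Bind a (\<lambda>d\<in>directions q a. free_bind q (t d) k)"

primrec run :: "('b, 'e) pre_poly \<Rightarrow> ('a \<Rightarrow> ('b, 'e, 'd) tree) \<Rightarrow> ('a, 'd, 'c) tree \<Rightarrow>
    ('b, 'e, 'c) tree" where
  "run q h (Return c) = Return c"
| "run q h (Bind a t) = free_bind q (h a) (\<lambda>d. run q h (t d))"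

text \<open>
  \<open>induced Arity Cod Inputs inputs g W F\<close>: \<open>F\<close> is the implementation that the box
  implementations \<open>g\<close> induce along \<open>W\<close>. A wire \<open>i\<close> forwards each call to the input interface
  \<open>i\<close>; a box runs its own implementation, answering the calls to its \<open>a\<close>-th domain interface
  by the implementation induced along the diagram plugged in at \<open>a\<close>.
\<close>

inductive induced ::
  "('b \<Rightarrow> 'r set) \<Rightarrow> ('b \<Rightarrow> ('a, 'd) pre_poly) \<Rightarrow> 'i set \<Rightarrow> ('i \<Rightarrow> ('a, 'd) pre_poly) \<Rightarrow>
   ('b \<Rightarrow> 'a \<Rightarrow> ('r \<times> 'a, 'd, 'd) tree) \<Rightarrow> ('b, 'r, 'i) diagram \<Rightarrow>
   ('a \<Rightarrow> ('i \<times> 'a, 'd, 'd) tree) \<Rightarrow> bool"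
  for Arity :: "'b \<Rightarrow> 'r set" and Cod :: "'b \<Rightarrow> ('a, 'd) pre_poly"
    and Inputs :: "'i set" and inputs :: "'i \<Rightarrow> ('a, 'd) pre_poly"
    and g :: "'b \<Rightarrow> 'a \<Rightarrow> ('r \<times> 'a, 'd, 'd) tree" where
  wire: "induced Arity Cod Inputs inputs g (Wire i)
     (\<lambda>x\<in>positions (inputs i). Bind (i, x) (\<lambda>d\<in>directions (inputs i) x. Return d))"
| box: "(\<And>a. a \<in> Arity b \<Longrightarrow> induced Arity Cod Inputs inputs g (f a) (H a)) \<Longrightarrow>
   induced Arity Cod Inputs inputs g (Box b f)
     (\<lambda>x\<in>positions (Cod b). run (poly_sum Inputs inputs) (\<lambda>(a, y). H a y) (g b x))"

end

theory Submission
  imports Defs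
begin

text \<open>An implementation of \<open>p\<close> in \<open>Free q\<close> extends to a translation
  of \<open>Free p\<close> into \<open>Free q\<close> by substituting it at every node
  (\<open>run_in_Free\<close>). Induction on the derivation of \<open>wiring\<close> then builds the
  induced implementation: a wire forwards calls to its input (\<open>forward_in_poly_arrow\<close>),
  and a box substitutes the implementations induced by its subdiagrams, copaired over the arity,
  into its own (\<open>run_in_poly_arrow\<close>).\<close>

lemma free_bind_in_Free:
  assumes "t \<in> Free q C" and "\<And>c. c \<in> C \<Longrightarrow> k c \<in> Free q E"
  shows "free_bind q t k \<in> Free q E"
  using assms(1)
proof induction
  case (Return c)
  then show ?case using assms(2) by simp
next
  case (Bind a s)
  then show ?case by (auto intro!: Free.Bind)
qed

text \<open>The leaves of \<open>h a\<close> are directions of \<open>p\<close> at \<open>a\<close>,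
  exactly the indices at which the subtrees of a node \<open>a\<close> are known to translate well,
  so \<open>free_bind_in_Free\<close> grafts them on.\<close>

lemma run_in_Free:
  assumes "t \<in> Free p C" and "\<And>a. a \<in> positions p \<Longrightarrow> h a \<in> Free q (directions p a)"
  shows "run q h t \<in> Free q C"
  using assms(1)
proof induction
  case (Return c)
  then show ?case by (simp add: Free.Return)
next
  case (Bind a s)
  then show ?case using assms(2) by (auto intro!: free_bind_in_Free)
qed

lemma positions_poly_sum: "positions (poly_sum U P) = (SIGMA u:U. positions (P u))"
  by (simp add: poly_sum_def)

lemma directions_poly_sum:
  "u \<in> U \<Longrightarrow> x \<in> positions (P u) \<Longrightarrow> directions (poly_sum U P) (u, x) = directions (P u) x"
  by (simp add: poly_sum_def)

lemma poly_arrow_mem: "f \<in> p \<Rrightarrow> F \<Longrightarrow> a \<in> positions p \<Longrightarrow> f a \<in> F (directions p a)"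
  unfolding poly_arrow_def by (rule PiE_mem)

text \<open>The summand \<open>P i\<close> keeps its directions inside the sum, so an answer to the
  call \<open>(i, x)\<close> already answers \<open>x\<close> and is returned unchanged.\<close>

lemma forward_in_poly_arrow:
  assumes "i \<in> I"
  shows "(\<lambda>x\<in>positions (P i). Bind (i, x) (\<lambda>d\<in>directions (P i) x. Return d))
    \<in> P i \<Rrightarrow> Free (poly_sum I P)"
  using assms
  by (auto simp: poly_arrow_def positions_poly_sum directions_poly_sum
      intro!: Free.Bind Free.Return)

lemma run_in_poly_arrow:
  assumes "f \<in> p \<Rrightarrow> Free (poly_sum U P)" and "\<And>u. u \<in> U \<Longrightarrow> H u \<in> P u \<Rrightarrow> Free q"
  shows "(\<lambda>x\<in>positions p. run q (\<lambda>(u, y). H u y) (f x)) \<in> p \<Rrightarrow> Free q"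
proof -
  have "run q (\<lambda>(u, y). H u y) (f x) \<in> Free q (directions p x)" if "x \<in> positions p" for x
  proof (rule run_in_Free)
    show "f x \<in> Free (poly_sum U P) (directions p x)"
      using assms(1) that by (rule poly_arrow_mem)
  next
    fix z assume "z \<in> positions (poly_sum U P)"
    then show "(case z of (u, y) \<Rightarrow> H u y) \<in> Free q (directions (poly_sum U P) z)"
      by (auto simp: positions_poly_sum directions_poly_sum intro: poly_arrow_mem[OF assms(2)])
  qed
  then show ?thesis by (simp add: poly_arrow_def)
qed

theorem theorem1:
  fixes Boxes :: "'b set" and Inputs :: "'i set"
    and Arity :: "'b \<Rightarrow> 'r set"
    and Dom :: "'b \<Rightarrow> 'r \<Rightarrow> ('a, 'd) pre_poly"
    and Cod :: "'b \<Rightarrow> ('a, 'd) pre_poly"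
    and inputs :: "'i \<Rightarrow> ('a, 'd) pre_poly"
    and p :: "('a, 'd) pre_poly"
    and W :: "('b, 'r, 'i) diagram"
    and g :: "'b \<Rightarrow> 'a \<Rightarrow> ('r \<times> 'a, 'd, 'd) tree"
  assumes "\<And>b a. b \<in> Boxes \<Longrightarrow> a \<in> Arity b \<Longrightarrow> polynomial (Dom b a)"
    and "\<And>b. b \<in> Boxes \<Longrightarrow> polynomial (Cod b)"
    and "\<And>i. i \<in> Inputs \<Longrightarrow> polynomial (inputs i)"
    and "polynomial p"
    and "wiring Boxes Arity Dom Cod Inputs inputs p W"
    and "\<And>b. b \<in> Boxes \<Longrightarrow> g b \<in> Cod b \<Rrightarrow> Free (poly_sum (Arity b) (Dom b))"
  shows "\<exists>F \<in> p \<Rrightarrow> Free (poly_sum Inputs inputs). induced Arity Cod Inputs inputs g W F"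
  using assms(5)
proof induction
  case (wire i)
  then show ?case by (blast intro: forward_in_poly_arrow induced.wire)
next
  case (box b f)
  \<comment> \<open>Choice turns the existential induction hypotheses into one family
    \<open>H\<close>. Its values outside \<open>Arity b\<close> are arbitrary, but
    \<open>g b\<close> only calls positions \<open>(a, y)\<close> with \<open>a\<close> in
    \<open>Arity b\<close>.\<close>
  then obtain H where H: "\<And>a. a \<in> Arity b \<Longrightarrow> H a \<in> Dom b a \<Rrightarrow> Free (poly_sum Inputs inputs)"
    "\<And>a. a \<in> Arity b \<Longrightarrow> induced Arity Cod Inputs inputs g (f a) (H a)"
    by metis
  show ?case
    \<comment> \<open>Both facts concern the same function, which is the witness.\<close>
    using run_in_poly_arrow[OF assms(6)[OF box.hyps(1)] H(1)]
      induced.box[of Arity b Cod Inputs inputs g f H, OF H(2)]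
    by blast
qed

end
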